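(* Let $s\ge 2$, $p\ge 2$ be integers and let $G$ be a graph in $\mathcal{G}(s,p)$ that is not (isomorphic to) $G_{min}(s,p)$, the graph in $\mathcal{G}(s,p)$ with the minimum number of edges. Then the number $\ell$ of non-integer Laplacian eigenvalues of $G$ (counted with multiplicity) satisfies $\ell=0$ or $\ell=2$.
   Context: All graphs are finite, simple and connected. The Laplacian matrix of $G$ is $L(G)=\mathcal{D}(G)-A(G)$ (degree matrix minus adjacency matrix). A vertex is simplicial if its neighbourhood is a clique. A minimal vertex separator is a set $S$ that, for some non-adjacent vertices $u,v$, separates $u$ and $v$ into different components of $G-S$ and is inclusion-minimal with this property. A graph is strictly chordal if it is obtained from a block graph (connected graph all of whose blocks are cliques) by adding zero or more true twins ($N[u]=N[v]$) to each vertex; a strictly interval graph is one that is both strictly chordal and an interval graph. For integers $s,p\ge 2$, $\mathcal{G}(s,p)$ is the set of $SI$-core graphs: strictly interval graphs $G$ with exactly two minimal vertex separators $S_1,S_2$, $|S_1|=|S_2|=s$, $S_1\cup S_2$ a maximal clique of $G$, and each $S_i$ having exactly $p$ simplicial vertices adjacent to it. Explicitly, $V(G)=S_1\cup S_2\cup P_1\cup P_2$ (disjoint), $|P_i|=p$, every vertex of $P_i$ is adjacent to all of $S_i$ and to no vertex of $S_{3-i}\cup P_{3-i}$, and $G[P_i]$ is a disjoint union of complete graphs. $G_{min}(s,p)$ is the member in which $P_1$ and $P_2$ are independent sets. *)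

theory Defs
  imports
    "Graph_Theory.Digraph_Component"
    "Graph_Theory.Digraph_Isomorphism"
    "Jordan_Normal_Form.Char_Poly"
begin

text \<open>
  Finite simple graphs are the loop-free symmetric digraphs without parallel arcs described by the
  locale predicate \<^const>\<open>graph\<close>; \<open>u \<rightarrow>\<^bsub>G\<^esub> v\<close> is adjacency and \<open>G \<restriction> W\<close> the subgraph induced by \<open>W\<close>.
\<close>

definition nbhd :: "('a, 'b) pre_digraph \<Rightarrow> 'a \<Rightarrow> 'a set" where
  "nbhd G v = {u. v \<rightarrow>\<^bsub>G\<^esub> u}"

definition clique :: "('a, 'b) pre_digraph \<Rightarrow> 'a set \<Rightarrow> bool" where
  "clique G K \<longleftrightarrow> K \<subseteq> verts G \<and> (\<forall>u\<in>K. \<forall>v\<in>K. u \<noteq> v \<longrightarrow> u \<rightarrow>\<^bsub>G\<^esub> v)"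

definition maximal_clique :: "('a, 'b) pre_digraph \<Rightarrow> 'a set \<Rightarrow> bool" where
  "maximal_clique G K \<longleftrightarrow> clique G K \<and> (\<forall>K'. clique G K' \<and> K \<subseteq> K' \<longrightarrow> K' = K)"

definition simplicial :: "('a, 'b) pre_digraph \<Rightarrow> 'a \<Rightarrow> bool" where
  "simplicial G v \<longleftrightarrow> v \<in> verts G \<and> clique G (nbhd G v)"

definition true_twins :: "('a, 'b) pre_digraph \<Rightarrow> 'a \<Rightarrow> 'a \<Rightarrow> bool" where
  "true_twins G u v \<longleftrightarrow> insert u (nbhd G u) = insert v (nbhd G v)"

definition separates :: "('a, 'b) pre_digraph \<Rightarrow> 'a set \<Rightarrow> 'a \<Rightarrow> 'a \<Rightarrow> bool" where
  "separates G S u v \<longleftrightarrow> S \<subseteq> verts G - {u, v} \<and> \<not> u \<rightarrow>\<^sup>*\<^bsub>G \<restriction> (verts G - S)\<^esub> v"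

definition minimal_vertex_separator :: "('a, 'b) pre_digraph \<Rightarrow> 'a set \<Rightarrow> bool" where
  "minimal_vertex_separator G S \<longleftrightarrow>
     (\<exists>u\<in>verts G. \<exists>v\<in>verts G. u \<noteq> v \<and> \<not> u \<rightarrow>\<^bsub>G\<^esub> v \<and>
        separates G S u v \<and> (\<forall>T. T \<subset> S \<longrightarrow> \<not> separates G T u v))"

definition cut_vertex :: "('a, 'b) pre_digraph \<Rightarrow> 'a \<Rightarrow> bool" where
  "cut_vertex G c \<longleftrightarrow> c \<in> verts G \<and>
     (\<exists>u\<in>verts G - {c}. \<exists>v\<in>verts G - {c}.
        u \<rightarrow>\<^sup>*\<^bsub>G\<^esub> v \<and> \<not> u \<rightarrow>\<^sup>*\<^bsub>G \<restriction> (verts G - {c})\<^esub> v)"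

definition nonseparable :: "('a, 'b) pre_digraph \<Rightarrow> bool" where
  "nonseparable G \<longleftrightarrow> Digraph_Component.connected G \<and> (\<forall>c. \<not> cut_vertex G c)"

text \<open>
  A maximal nonseparable subgraph is induced, since adding edges between its vertices keeps it
  nonseparable; so a block is identified with its vertex set.
\<close>

definition block :: "('a, 'b) pre_digraph \<Rightarrow> 'a set \<Rightarrow> bool" where
  "block G B \<longleftrightarrow> B \<subseteq> verts G \<and> nonseparable (G \<restriction> B) \<and>
     (\<forall>B'. B \<subset> B' \<and> B' \<subseteq> verts G \<longrightarrow> \<not> nonseparable (G \<restriction> B'))"

definition block_graph :: "('a, 'b) pre_digraph \<Rightarrow> bool" where
  "block_graph G \<longleftrightarrow> graph G \<and> Digraph_Component.connected G \<and> (\<forall>B. block G B \<longrightarrow> clique G B)"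

text \<open>
  The original block graph is the subgraph induced by \<open>W\<close>. A vertex added as a true twin of \<open>w\<close>
  stays a true twin of \<open>w\<close> when twins of other vertices are added, so twinhood can be tested in
  the final graph \<open>G\<close>.
\<close>

definition strictly_chordal :: "('a, 'b) pre_digraph \<Rightarrow> bool" where
  "strictly_chordal G \<longleftrightarrow> graph G \<and>
     (\<exists>W \<subseteq> verts G. block_graph (G \<restriction> W) \<and> (\<forall>v \<in> verts G - W. \<exists>w\<in>W. true_twins G v w))"

definition interval_graph :: "('a, 'b) pre_digraph \<Rightarrow> bool" where
  "interval_graph G \<longleftrightarrow> graph G \<and>
     (\<exists>l r :: 'a \<Rightarrow> real. (\<forall>v\<in>verts G. l v \<le> r v) \<and>
        (\<forall>u\<in>verts G. \<forall>v\<in>verts G. u \<noteq> v \<longrightarrow>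
           (u \<rightarrow>\<^bsub>G\<^esub> v \<longleftrightarrow> {l u..r u} \<inter> {l v..r v} \<noteq> {})))"

definition strictly_interval :: "('a, 'b) pre_digraph \<Rightarrow> bool" where
  "strictly_interval G \<longleftrightarrow> strictly_chordal G \<and> interval_graph G"

text \<open>
  A simplicial vertex counts as adjacent to a separator when it is adjacent to all of its vertices.
\<close>

definition SI_core :: "nat \<Rightarrow> nat \<Rightarrow> ('a, 'b) pre_digraph set" where
  "SI_core s p = {G. strictly_interval G \<and>
     (\<exists>S1 S2. S1 \<noteq> S2 \<and> {S. minimal_vertex_separator G S} = {S1, S2} \<and>
        card S1 = s \<and> card S2 = s \<and> maximal_clique G (S1 \<union> S2) \<and>
        (\<forall>S\<in>{S1, S2}. card {v. simplicial G v \<and> S \<subseteq> nbhd G v} = p))}"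

text \<open>
  In the vertex \<open>(i, k)\<close> the Boolean \<open>i\<close> selects the side; \<open>(i, k)\<close> lies in the separator \<open>S\<^sub>i\<close>
  for \<open>k < s\<close> and in the independent set \<open>P\<^sub>i\<close> for \<open>s \<le> k < s + p\<close>.
\<close>

definition G_min :: "nat \<Rightarrow> nat \<Rightarrow> (bool \<times> nat, (bool \<times> nat) \<times> (bool \<times> nat)) pre_digraph" where
  "G_min s p = with_proj
     \<lparr> pverts = UNIV \<times> {..<s + p},
       parcs = {((i, k), (j, m)). k < s + p \<and> m < s + p \<and> (i, k) \<noteq> (j, m) \<and>
                  (k < s \<and> m < s \<or> i = j \<and> (k < s \<or> m < s))} \<rparr>"

text \<open>
  The matrices are taken with respect to an enumeration \<open>vs\<close> of the vertices. In a symmetric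
  digraph the out-degree of a vertex is its degree in the undirected sense.
\<close>

definition degree_matrix :: "('a, 'b) pre_digraph \<Rightarrow> 'a list \<Rightarrow> real mat" where
  "degree_matrix G vs = mat (length vs) (length vs)
     (\<lambda>(i, j). if i = j then real (out_degree G (vs ! i)) else 0)"

definition adjacency_matrix :: "('a, 'b) pre_digraph \<Rightarrow> 'a list \<Rightarrow> real mat" where
  "adjacency_matrix G vs = mat (length vs) (length vs)
     (\<lambda>(i, j). if vs ! i \<rightarrow>\<^bsub>G\<^esub> vs ! j then 1 else 0)"

definition laplacian :: "('a, 'b) pre_digraph \<Rightarrow> 'a list \<Rightarrow> real mat" where
  "laplacian G vs = degree_matrix G vs - adjacency_matrix G vs"

text \<open>
  Algebraic multiplicities. Only real eigenvalues are counted, which are all eigenvalues of a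
  symmetric matrix.
\<close>

definition noninteger_eigenvalue_count :: "real mat \<Rightarrow> nat" where
  "noninteger_eigenvalue_count A =
     (\<Sum>x \<in> {x. eigenvalue A x \<and> x \<notin> \<int>}. Polynomial.order x (char_poly A))"

end

theory Submission
  imports Defs "Jordan_Normal_Form.Schur_Decomposition"
begin

text \<open>
  In a core graph every vertex outside the clique \<open>S\<^sub>1 \<union> S\<^sub>2\<close> is simplicial, and its trace on that
  clique is a minimal separator, hence \<open>S\<^sub>1\<close> or \<open>S\<^sub>2\<close>; the separators are disjoint because a block
  graph with twins has no gem. An eigenfunction \<open>f\<close> of the Laplacian with non-integral
  eigenvalue \<open>x\<close> takes equal values at twins, so it is constant on \<open>S\<^sub>1\<close>, \<open>S\<^sub>2\<close>, \<open>P\<^sub>1\<close> and \<open>P\<^sub>2\<close>; the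
  quotient matrix splits into a symmetric part with eigenvalues \<open>0\<close> and \<open>s + p\<close>, and an
  antisymmetric part with characteristic polynomial \<open>x\<^sup>2 - (3 s + p) x + 2 s\<^sup>2\<close>. The roots of the
  latter are distinct with integral sum, so either both or none are integers, and their eigenspaces
  are one-dimensional.
\<close>

section \<open>Separators and simplicial vertices\<close>

lemma dominates_induce_iff: "u \<rightarrow>\<^bsub>G \<restriction> W\<^esub> v \<longleftrightarrow> u \<rightarrow>\<^bsub>G\<^esub> v \<and> u \<in> W \<and> v \<in> W"
  by (auto simp: arcs_ends_conv)

text \<open>Unreachability is always proved through this rule: exhibit a set closed under adjacency
  that contains the source and misses the target.\<close>

lemma reachable_closed:
  assumes "u \<rightarrow>\<^sup>*\<^bsub>G\<^esub> v" and "u \<in> C" and "\<And>x y. x \<in> C \<Longrightarrow> x \<rightarrow>\<^bsub>G\<^esub> y \<Longrightarrow> y \<in> C"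
  shows "v \<in> C"
  using assms(1) unfolding reachable_def
  by (induct rule: rtrancl_on_induct) (use assms in auto)

lemma (in graph) dominates_sym: "u \<rightarrow>\<^bsub>G\<^esub> v \<Longrightarrow> v \<rightarrow>\<^bsub>G\<^esub> u"
  by (rule graph_symmetric)

lemma (in graph) separates_common_neighbour:
  assumes "separates G S u v" and "u \<rightarrow>\<^bsub>G\<^esub> w" and "w \<rightarrow>\<^bsub>G\<^esub> v"
  shows "w \<in> S"
proof (rule ccontr)
  assume "w \<notin> S"
  interpret I: wf_digraph "G \<restriction> (verts G - S)" by blast
  have S: "S \<subseteq> verts G - {u, v}" and n: "\<not> u \<rightarrow>\<^sup>*\<^bsub>G \<restriction> (verts G - S)\<^esub> v"
    using assms(1) unfolding separates_def by auto
  have "u \<rightarrow>\<^bsub>G \<restriction> (verts G - S)\<^esub> w" "w \<rightarrow>\<^bsub>G \<restriction> (verts G - S)\<^esub> v"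
    using S assms(2,3) \<open>w \<notin> S\<close> by (auto simp: dominates_induce_iff dest: adj_in_verts)
  then show False using n by (meson I.adj_reachable_trans I.reachable_adjI)
qed

text \<open>Minimality comes for free when \<open>S\<close> consists of common neighbours: a proper
  subset misses some \<open>w\<close>, and the path \<open>u\<close>, \<open>w\<close>,
  \<open>v\<close> survives its removal.\<close>

lemma (in graph) minimal_vertex_separatorI:
  assumes "u \<in> verts G" "v \<in> verts G" "u \<noteq> v" "\<not> u \<rightarrow>\<^bsub>G\<^esub> v"
    and "separates G S u v" and "\<And>w. w \<in> S \<Longrightarrow> u \<rightarrow>\<^bsub>G\<^esub> w \<and> w \<rightarrow>\<^bsub>G\<^esub> v"
  shows "minimal_vertex_separator G S"
proof -
  have "\<not> separates G T u v" if T: "T \<subset> S" for T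
  proof
    assume sep: "separates G T u v"
    obtain w where "w \<in> S" "w \<notin> T" using T by blast
    then show False using assms(6)[of w] separates_common_neighbour[OF sep, of w] by simp
  qed
  then show ?thesis unfolding minimal_vertex_separator_def using assms(1-5) by blast
qed

text \<open>Removing everything except the non-adjacent \<open>u\<close> and \<open>v\<close>
  separates them, so the finite family of separating sets is non-empty and has a minimal
  member.\<close>

lemma (in graph) ex_minimal_separates:
  assumes "u \<in> verts G" "v \<in> verts G" "u \<noteq> v" "\<not> u \<rightarrow>\<^bsub>G\<^esub> v"
  obtains S where "minimal_vertex_separator G S" "separates G S u v"
proof -
  let ?F = "{S. separates G S u v}"
  have "?F \<subseteq> Pow (verts G)" by (auto simp: separates_def)
  then have fin: "finite ?F" by (rule finite_subset) simp
  have "\<not> u \<rightarrow>\<^sup>*\<^bsub>G \<restriction> {u, v}\<^esub> v"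
  proof
    assume "u \<rightarrow>\<^sup>*\<^bsub>G \<restriction> {u, v}\<^esub> v"
    then have "v \<in> {u}"
      by (rule reachable_closed) (use assms(4) adj_not_same in \<open>auto simp: dominates_induce_iff\<close>)
    then show False using assms(3) by simp
  qed
  moreover have "verts G - (verts G - {u, v}) = {u, v}" using assms by auto
  ultimately have "verts G - {u, v} \<in> ?F" by (simp add: separates_def)
  then obtain S where S: "S \<in> ?F" and min: "\<forall>T\<in>?F. T \<subseteq> S \<longrightarrow> S = T"
    using finite_has_minimal[OF fin] by blast
  have "minimal_vertex_separator G S"
    unfolding minimal_vertex_separator_def using assms S min by blast
  with S show thesis using that by blast
qed

text \<open>Two non-adjacent neighbours of \<open>v\<close> would be separated by some minimal
  separator, which has to contain their common neighbour \<open>v\<close>.\<close>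

lemma (in graph) simplicial_if_no_separator:
  assumes "v \<in> verts G" and "\<And>S. minimal_vertex_separator G S \<Longrightarrow> v \<notin> S"
  shows "simplicial G v"
  unfolding simplicial_def clique_def
proof (intro conjI ballI impI)
  show "v \<in> verts G" by fact
  show "nbhd G v \<subseteq> verts G" by (auto simp: nbhd_def dest: adj_in_verts)
  fix a b assume ab: "a \<in> nbhd G v" "b \<in> nbhd G v" "a \<noteq> b"
  show "a \<rightarrow>\<^bsub>G\<^esub> b"
  proof (rule ccontr)
    assume "\<not> a \<rightarrow>\<^bsub>G\<^esub> b"
    then obtain S where "minimal_vertex_separator G S" "separates G S a b"
      using ex_minimal_separates ab by (metis adj_in_verts(2) mem_Collect_eq nbhd_def)
    then show False
      using assms(2) separates_common_neighbour ab dominates_sym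
      by (metis mem_Collect_eq nbhd_def)
  qed
qed

text \<open>By minimality, restoring \<open>x\<close> reconnects \<open>u\<close> and
  \<open>v\<close>, so \<open>x\<close> has a neighbour in each of their components of
  \<open>G - S\<close>. These two neighbours are distinct and non-adjacent.\<close>

lemma (in graph) minimal_vertex_separator_not_simplicial:
  assumes "minimal_vertex_separator G S" and "x \<in> S"
  shows "\<not> simplicial G x"
proof -
  obtain u v where uv: "u \<in> verts G" "v \<in> verts G" "separates G S u v"
    and min: "\<And>T. T \<subset> S \<Longrightarrow> \<not> separates G T u v"
    using assms(1) unfolding minimal_vertex_separator_def by blast
  let ?H = "G \<restriction> (verts G - S)" and ?K = "G \<restriction> (verts G - (S - {x}))"
  interpret H: wf_digraph ?H by blast
  interpret K: wf_digraph ?K by blast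
  have symH: "symmetric ?H" and symK: "symmetric ?K"
    using induced_graph_imp_symmetric[OF sym_arcs] by blast+
  have S: "S \<subseteq> verts G - {u, v}" and nuv: "\<not> u \<rightarrow>\<^sup>*\<^bsub>?H\<^esub> v"
    using uv(3) by (auto simp: separates_def)
  have "S - {x} \<subset> S" using assms(2) by auto
  then have "\<not> separates G (S - {x}) u v" by (rule min)
  then have uKv: "u \<rightarrow>\<^sup>*\<^bsub>?K\<^esub> v" using S by (auto simp: separates_def)
  then have vKu: "v \<rightarrow>\<^sup>*\<^bsub>?K\<^esub> u" by (rule symmetric_reachable[OF symK])
  \<comment> \<open>If \<open>x\<close> had no neighbour in the \<open>?H\<close>-component of
    \<open>y\<close>, that component would stay closed in \<open>?K\<close>. The claim is used from
    both ends, at \<open>u\<close> and at \<open>v\<close>.\<close>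
  have nbr: "\<exists>a. x \<rightarrow>\<^bsub>G\<^esub> a \<and> y \<rightarrow>\<^sup>*\<^bsub>?H\<^esub> a"
    if y: "y \<in> verts G - S" and yz: "y \<rightarrow>\<^sup>*\<^bsub>?K\<^esub> z" and n: "\<not> y \<rightarrow>\<^sup>*\<^bsub>?H\<^esub> z" for y z
  proof (rule ccontr)
    assume no: "\<nexists>a. x \<rightarrow>\<^bsub>G\<^esub> a \<and> y \<rightarrow>\<^sup>*\<^bsub>?H\<^esub> a"
    have "z \<in> {a. y \<rightarrow>\<^sup>*\<^bsub>?H\<^esub> a}"
    proof (rule reachable_closed[OF yz])
      show "y \<in> {a. y \<rightarrow>\<^sup>*\<^bsub>?H\<^esub> a}" using y by simp
      fix a b assume a: "a \<in> {a. y \<rightarrow>\<^sup>*\<^bsub>?H\<^esub> a}" and ab: "a \<rightarrow>\<^bsub>?K\<^esub> b"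
      have "a \<in> verts G - S" using a H.reachable_in_verts(2) by fastforce
      moreover have "b \<noteq> x" using no a ab dominates_sym by (auto simp: dominates_induce_iff)
      ultimately have "a \<rightarrow>\<^bsub>?H\<^esub> b" using ab by (auto simp: dominates_induce_iff)
      then show "b \<in> {a. y \<rightarrow>\<^sup>*\<^bsub>?H\<^esub> a}" using a H.reachable_adj_trans by blast
    qed
    then show False using n by simp
  qed
  obtain a where a: "x \<rightarrow>\<^bsub>G\<^esub> a" "u \<rightarrow>\<^sup>*\<^bsub>?H\<^esub> a" using nbr[OF _ uKv nuv] uv S by blast
  have "\<not> v \<rightarrow>\<^sup>*\<^bsub>?H\<^esub> u" using nuv symmetric_reachable[OF symH] by blast
  then obtain b where b: "x \<rightarrow>\<^bsub>G\<^esub> b" "v \<rightarrow>\<^sup>*\<^bsub>?H\<^esub> b" using nbr[OF _ vKu] uv S by blast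
  have b': "b \<rightarrow>\<^sup>*\<^bsub>?H\<^esub> v" using symmetric_reachable[OF symH b(2)] .
  have "a \<noteq> b" using a b' nuv H.reachable_trans by blast
  moreover have "\<not> a \<rightarrow>\<^bsub>G\<^esub> b"
  proof
    assume "a \<rightarrow>\<^bsub>G\<^esub> b"
    then have "a \<rightarrow>\<^bsub>?H\<^esub> b"
      using H.reachable_in_verts(2)[OF a(2)] H.reachable_in_verts(2)[OF b(2)]
      by (simp add: dominates_induce_iff)
    then show False using a(2) b' nuv H.reachable_adj_trans H.reachable_trans by blast
  qed
  ultimately show ?thesis using a(1) b(1) by (auto simp: simplicial_def clique_def nbhd_def)
qed

section \<open>Diamonds in strictly chordal graphs\<close>

lemma (in graph) diamond_nonseparable:
  assumes e: "c \<rightarrow>\<^bsub>G\<^esub> x" "c \<rightarrow>\<^bsub>G\<^esub> y" "x \<rightarrow>\<^bsub>G\<^esub> y" "x \<rightarrow>\<^bsub>G\<^esub> z" "y \<rightarrow>\<^bsub>G\<^esub> z"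
  shows "nonseparable (G \<restriction> {c, x, y, z})"
proof -
  let ?D = "{c, x, y, z}"
  interpret D: wf_digraph "G \<restriction> ?D" by blast
  have ne: "x \<noteq> y" using e(3) adj_not_same by blast
  have reach: "u \<rightarrow>\<^sup>*\<^bsub>(G \<restriction> ?D) \<restriction> (?D - {k})\<^esub> v" if u: "u \<in> ?D - {k}" and v: "v \<in> ?D - {k}" for u v k
  proof -
    let ?E = "(G \<restriction> ?D) \<restriction> (?D - {k})"
    interpret E: wf_digraph ?E by blast
    \<comment> \<open>Both \<open>x\<close> and \<open>y\<close> are adjacent to all other vertices
      of the diamond; whichever of them survives the deletion of \<open>k\<close> serves as a
      hub.\<close>
    obtain m where m: "m \<in> {x, y}" "m \<noteq> k" using ne by blast
    have "a \<rightarrow>\<^sup>*\<^bsub>?E\<^esub> m" "m \<rightarrow>\<^sup>*\<^bsub>?E\<^esub> a" if a: "a \<in> ?D - {k}" for a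
    proof -
      have "a = m \<or> a \<rightarrow>\<^bsub>?E\<^esub> m \<and> m \<rightarrow>\<^bsub>?E\<^esub> a"
        using a m e e[THEN dominates_sym] by (auto simp: dominates_induce_iff)
      moreover have "m \<in> verts ?E" using m by auto
      ultimately show "a \<rightarrow>\<^sup>*\<^bsub>?E\<^esub> m" "m \<rightarrow>\<^sup>*\<^bsub>?E\<^esub> a" by auto
    qed
    from E.reachable_trans[OF this(1)[OF u] this(2)[OF v]] show ?thesis .
  qed
  have "u \<rightarrow>\<^sup>*\<^bsub>G \<restriction> ?D\<^esub> v" if u: "u \<in> ?D" and v: "v \<in> ?D" for u v
  proof -
    have "a \<rightarrow>\<^sup>*\<^bsub>G \<restriction> ?D\<^esub> x" "x \<rightarrow>\<^sup>*\<^bsub>G \<restriction> ?D\<^esub> a" if a: "a \<in> ?D" for a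
    proof -
      have "a = x \<or> a \<rightarrow>\<^bsub>G \<restriction> ?D\<^esub> x \<and> x \<rightarrow>\<^bsub>G \<restriction> ?D\<^esub> a"
        using a e e[THEN dominates_sym] by (auto simp: dominates_induce_iff)
      then show "a \<rightarrow>\<^sup>*\<^bsub>G \<restriction> ?D\<^esub> x" "x \<rightarrow>\<^sup>*\<^bsub>G \<restriction> ?D\<^esub> a" by auto
    qed
    from D.reachable_trans[OF this(1)[OF u] this(2)[OF v]] show ?thesis .
  qed
  then have "Digraph_Component.connected (G \<restriction> ?D)"
    by (intro D.connectedI D.reachable_mk_symmetricI) auto
  then show ?thesis using reach unfolding nonseparable_def cut_vertex_def by simp
qed

lemma (in graph) nonseparable_subset_block:
  assumes "D \<subseteq> verts G" and "nonseparable (G \<restriction> D)"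
  obtains B where "block G B" and "D \<subseteq> B"
proof -
  let ?F = "{B. D \<subseteq> B \<and> B \<subseteq> verts G \<and> nonseparable (G \<restriction> B)}"
  have "?F \<subseteq> Pow (verts G)" by auto
  then have "finite ?F" by (rule finite_subset) simp
  moreover have "?F \<noteq> {}" using assms by blast
  ultimately obtain B where B: "B \<in> ?F" and mx: "\<forall>C\<in>?F. B \<subseteq> C \<longrightarrow> B = C"
    using finite_has_maximal[of ?F] by blast
  have "block G B" unfolding block_def using B mx by blast
  with B that show thesis by blast
qed

text \<open>The diamond is nonseparable, so it lies in a block, and blocks are cliques here.\<close>

lemma block_graph_diamond:
  assumes "block_graph G"
    and e: "c \<rightarrow>\<^bsub>G\<^esub> x" "c \<rightarrow>\<^bsub>G\<^esub> y" "x \<rightarrow>\<^bsub>G\<^esub> y" "x \<rightarrow>\<^bsub>G\<^esub> z" "y \<rightarrow>\<^bsub>G\<^esub> z" and "c \<noteq> z"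
  shows "c \<rightarrow>\<^bsub>G\<^esub> z"
proof -
  interpret graph G using assms(1) by (simp add: block_graph_def)
  have "{c, x, y, z} \<subseteq> verts G" using e by (auto dest: adj_in_verts)
  then obtain B where "block G B" "{c, x, y, z} \<subseteq> B"
    using nonseparable_subset_block diamond_nonseparable[OF e] by metis
  then show ?thesis using assms(1,7) unfolding block_graph_def clique_def by simp
qed

text \<open>
  A diamond whose two middle vertices are not twins has pairwise non-twin vertices, hence it
  survives the replacement of every vertex by its representative in the block graph.
\<close>

lemma strictly_chordal_diamond:
  assumes "strictly_chordal G"
    and e: "c \<rightarrow>\<^bsub>G\<^esub> x" "c \<rightarrow>\<^bsub>G\<^esub> y" "x \<rightarrow>\<^bsub>G\<^esub> y" "x \<rightarrow>\<^bsub>G\<^esub> z" "y \<rightarrow>\<^bsub>G\<^esub> z"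
    and "c \<noteq> z" and "\<not> c \<rightarrow>\<^bsub>G\<^esub> z"
  shows "true_twins G x y"
proof (rule ccontr)
  assume ntw: "\<not> true_twins G x y"
  interpret graph G using assms(1) by (simp add: strictly_chordal_def)
  obtain W where W: "W \<subseteq> verts G" "block_graph (G \<restriction> W)"
    and tw: "\<forall>v \<in> verts G - W. \<exists>w\<in>W. true_twins G v w"
    using assms(1) unfolding strictly_chordal_def by blast
  let ?N = "\<lambda>v. insert v (nbhd G v)"
  have "\<exists>w\<in>W. ?N v = ?N w" if "v \<in> verts G" for v
    using tw that by (cases "v \<in> W") (auto simp: true_twins_def)
  then obtain r where r: "\<And>v. v \<in> verts G \<Longrightarrow> r v \<in> W \<and> ?N v = ?N (r v)" by metis
  have adjN: "u \<rightarrow>\<^bsub>G\<^esub> v \<longleftrightarrow> u \<noteq> v \<and> v \<in> ?N u" for u v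
    using adj_not_same by (auto simp: nbhd_def)
  have symN: "v \<in> ?N u \<longleftrightarrow> u \<in> ?N v" for u v
    using dominates_sym by (auto simp: nbhd_def)
  \<comment> \<open>Membership in closed neighbourhoods is symmetric, so \<open>u\<close> and
    \<open>v\<close> can be exchanged for their twins one after the other.\<close>
  have inN: "v \<in> ?N u \<longleftrightarrow> r v \<in> ?N (r u)" if "u \<in> verts G" "v \<in> verts G" for u v
  proof -
    have "v \<in> ?N u \<longleftrightarrow> v \<in> ?N (r u)" using r[OF that(1)] by blast
    also have "\<dots> \<longleftrightarrow> r u \<in> ?N v" by (rule symN)
    also have "\<dots> \<longleftrightarrow> r u \<in> ?N (r v)" using r[OF that(2)] by blast
    also have "\<dots> \<longleftrightarrow> r v \<in> ?N (r u)" by (rule symN)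
    finally show ?thesis .
  qed
  have V: "c \<in> verts G" "x \<in> verts G" "y \<in> verts G" "z \<in> verts G"
    using e by (auto dest: adj_in_verts)
  \<comment> \<open>Different closed neighbourhoods keep the two representatives distinct, so closed
    membership becomes genuine adjacency.\<close>
  have adj: "r u \<rightarrow>\<^bsub>G \<restriction> W\<^esub> r v" if "u \<rightarrow>\<^bsub>G\<^esub> v" "?N u \<noteq> ?N v" for u v
  proof -
    have uv: "u \<in> verts G" "v \<in> verts G" using that(1) by (auto dest: adj_in_verts)
    have "r u \<noteq> r v" using r uv that(2) by metis
    moreover have "r v \<in> ?N (r u)" using that(1) inN[OF uv] adjN by blast
    ultimately show ?thesis using r[OF uv(1)] r[OF uv(2)] adjN by (auto simp: dominates_induce_iff)
  qed
  have zc: "z \<notin> ?N c" and cz: "c \<notin> ?N z" using assms(7,8) symN adjN by blast+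
  have mem: "z \<in> ?N x" "z \<in> ?N y" "c \<in> ?N x" "c \<in> ?N y"
    using e dominates_sym by (auto simp: nbhd_def)
  have n: "?N c \<noteq> ?N x" "?N c \<noteq> ?N y" "?N x \<noteq> ?N z" "?N y \<noteq> ?N z"
    using zc cz mem by blast+
  have nxy: "?N x \<noteq> ?N y" using ntw by (simp add: true_twins_def)
  have "r z \<notin> ?N (r c)" using zc inN[OF V(1,4)] by blast
  then have "r c \<noteq> r z" "\<not> r c \<rightarrow>\<^bsub>G\<^esub> r z" by (auto simp: nbhd_def)
  then show False
    using block_graph_diamond[OF W(2) adj[OF e(1) n(1)] adj[OF e(2) n(2)] adj[OF e(3) nxy]
        adj[OF e(4) n(3)] adj[OF e(5) n(4)]]
    by (simp add: dominates_induce_iff)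
qed

section \<open>The structure of core graphs\<close>

text \<open>Sides are indexed by Booleans, so that \<open>\<not> i\<close> is the opposite side and
  each fact is stated once. The assumption \<open>twins_P\<close> encodes that \<open>P i\<close>
  induces a disjoint union of complete graphs.\<close>

locale core_parts = graph G for G :: "('a, 'b) pre_digraph" +
  fixes s p :: nat and S P :: "bool \<Rightarrow> 'a set"
  assumes verts_eq: "verts G = (\<Union>i. S i \<union> P i)"
    and S_disjoint: "S i \<inter> S (\<not> i) = {}"
    and P_disjoint: "P i \<inter> P (\<not> i) = {}"
    and SP_disjoint: "S i \<inter> P j = {}"
    and card_S: "card (S i) = s"
    and card_P: "card (P i) = p"
    and nbhd_S: "v \<in> S i \<Longrightarrow> nbhd G v = S i \<union> S (\<not> i) \<union> P i - {v}"
    and nbhd_P: "v \<in> P i \<Longrightarrow> S i \<subseteq> nbhd G v \<and> nbhd G v \<subseteq> S i \<union> P i"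
    and twins_P: "v \<in> P i \<Longrightarrow> w \<in> P i \<Longrightarrow> v \<rightarrow>\<^bsub>G\<^esub> w \<Longrightarrow> true_twins G v w"

text \<open>The non-simplicial vertices turn out to be exactly those of
  \<open>S1 \<union> S2\<close>; every other vertex is assigned to a side by its neighbours in that
  clique.\<close>

lemma SI_core_parts:
  assumes G: "G \<in> SI_core s p" and p: "p \<ge> 2"
  obtains S P where "core_parts G s p S P"
proof -
  obtain S1 S2 where neq: "S1 \<noteq> S2" and seps: "{S. minimal_vertex_separator G S} = {S1, S2}"
    and cS1: "card S1 = s" and cS2: "card S2 = s" and K: "maximal_clique G (S1 \<union> S2)"
    and cP1: "card {v. simplicial G v \<and> S1 \<subseteq> nbhd G v} = p"
    and cP2: "card {v. simplicial G v \<and> S2 \<subseteq> nbhd G v} = p"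
    and sc: "strictly_chordal G"
    using G unfolding SI_core_def strictly_interval_def by blast
  interpret graph G using sc by (simp add: strictly_chordal_def)
  define S where "S = (\<lambda>i. if i then S1 else S2)"
  define P where "P = (\<lambda>i. {v. simplicial G v \<and> S i \<subseteq> nbhd G v})"
  let ?K = "S1 \<union> S2"
  have SK: "S i \<union> S (\<not> i) = ?K" for i by (cases i) (auto simp: S_def)
  have clK: "clique G ?K" using K by (simp add: maximal_clique_def)
  have KV: "?K \<subseteq> verts G" using clK by (simp add: clique_def)
  have finK: "finite ?K" using KV finite_verts by (rule finite_subset)
  have finS: "finite (S i)" for i using finK by (simp add: S_def)
  have cS: "card (S i) = s" for i using cS1 cS2 by (simp add: S_def)
  have cP: "card (P i) = p" for i using cP1 cP2 by (simp add: S_def P_def)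
  have Sneq: "S i \<noteq> S (\<not> i)" for i using neq by (cases i) (auto simp: S_def)
  have sep_iff: "minimal_vertex_separator G T \<longleftrightarrow> T = S1 \<or> T = S2" for T
    using arg_cong[OF seps, of "\<lambda>X. T \<in> X"] by simp
  have nsimp: "\<not> simplicial G v" if "v \<in> ?K" for v
    using that sep_iff minimal_vertex_separator_not_simplicial by (metis UnE)
  have simp: "simplicial G v" if "v \<in> verts G" "v \<notin> ?K" for v
    using that sep_iff simplicial_if_no_separator by (metis UnI1 UnI2)
  have adjK: "u \<rightarrow>\<^bsub>G\<^esub> v" if "u \<in> ?K" "v \<in> ?K" "u \<noteq> v" for u v
    using that clK by (simp add: clique_def)
  \<comment> \<open>Maximality of the clique provides some \<open>u\<close> in \<open>?K\<close> not
    adjacent to \<open>v\<close>. The trace \<open>?T\<close> separates \<open>v\<close> from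
    \<open>u\<close> and consists of their common neighbours, hence is a minimal separator.\<close>
  have trace: "\<exists>i. nbhd G v \<inter> ?K = S i" if v: "v \<in> verts G" "v \<notin> ?K" for v
  proof -
    let ?T = "nbhd G v \<inter> ?K"
    have "\<exists>u\<in>?K. \<not> v \<rightarrow>\<^bsub>G\<^esub> u"
    proof (rule ccontr)
      assume *: "\<not> (\<exists>u\<in>?K. \<not> v \<rightarrow>\<^bsub>G\<^esub> u)"
      then have "clique G (insert v ?K)"
        using clK v dominates_sym by (auto simp: clique_def)
      then show False using K v(2) unfolding maximal_clique_def by blast
    qed
    then obtain u where u: "u \<in> ?K" "\<not> v \<rightarrow>\<^bsub>G\<^esub> u" by blast
    have sep: "separates G ?T v u"
      unfolding separates_def
    proof
      show "?T \<subseteq> verts G - {v, u}" using u v KV by (auto simp: nbhd_def)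
      show "\<not> v \<rightarrow>\<^sup>*\<^bsub>G \<restriction> (verts G - ?T)\<^esub> u"
      proof
        assume "v \<rightarrow>\<^sup>*\<^bsub>G \<restriction> (verts G - ?T)\<^esub> u"
        \<comment> \<open>This set is closed once \<open>?T\<close> is removed: a neighbour
          \<open>a\<close> of \<open>v\<close> outside \<open>?K\<close> is simplicial, so every
          further neighbour of \<open>a\<close> is already adjacent to \<open>v\<close>.\<close>
        then have "u \<in> insert v (nbhd G v) - ?K"
        proof (rule reachable_closed)
          show "v \<in> insert v (nbhd G v) - ?K" using v by simp
          fix a b assume a: "a \<in> insert v (nbhd G v) - ?K"
            and "a \<rightarrow>\<^bsub>G \<restriction> (verts G - ?T)\<^esub> b"
          then have ab: "a \<rightarrow>\<^bsub>G\<^esub> b" and b: "b \<notin> ?T" by (auto simp: dominates_induce_iff)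
          have "b \<in> insert v (nbhd G v)"
          proof (cases "a = v")
            case True then show ?thesis using ab by (simp add: nbhd_def)
          next
            case False
            then have av: "a \<rightarrow>\<^bsub>G\<^esub> v" using a dominates_sym by (auto simp: nbhd_def)
            have "a \<in> verts G" using ab by (auto dest: adj_in_verts)
            then have "simplicial G a" using a simp by blast
            then have "b \<noteq> v \<Longrightarrow> v \<rightarrow>\<^bsub>G\<^esub> b"
              using av ab by (simp add: simplicial_def clique_def nbhd_def)
            then show ?thesis by (auto simp: nbhd_def)
          qed
          then show "b \<in> insert v (nbhd G v) - ?K" using b v by blast
        qed
        then show False using u by blast
      qed
    qed
    have "minimal_vertex_separator G ?T"
    proof (rule minimal_vertex_separatorI[OF _ _ _ u(2) sep])
      show "v \<in> verts G" "u \<in> verts G" "v \<noteq> u" using v u KV by auto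
      fix w assume w: "w \<in> ?T"
      then have "w \<noteq> u" using u by (auto simp: nbhd_def)
      then show "v \<rightarrow>\<^bsub>G\<^esub> w \<and> w \<rightarrow>\<^bsub>G\<^esub> u" using w u adjK by (auto simp: nbhd_def)
    qed
    then have "?T = S1 \<or> ?T = S2" by (simp only: sep_iff)
    then have "?T = S True \<or> ?T = S False" by (simp add: S_def)
    then show ?thesis by metis
  qed
  have PV: "v \<in> verts G" "v \<notin> ?K" if "v \<in> P i" for v i
    using that nsimp by (auto simp: P_def simplicial_def)
  \<comment> \<open>Membership in \<open>P i\<close> only gives an inclusion of \<open>S i\<close>
    in the trace; the equal sizes of the separators turn it into equality.\<close>
  have traceP: "nbhd G v \<inter> ?K = S i" if v: "v \<in> P i" for v i
  proof -
    obtain j where j: "nbhd G v \<inter> ?K = S j" using trace PV[OF v] by blast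
    have "S i \<subseteq> S j" using v j SK[of i] by (auto simp: P_def)
    then show ?thesis using j card_subset_eq[OF finS] cS by metis
  qed
  have Pne: "P i \<noteq> {}" for i using cP[of i] p by auto
  \<comment> \<open>A common vertex \<open>x\<close> would be the apex over the path
    \<open>c\<close>, \<open>y\<close>, \<open>z\<close>, \<open>d\<close>. The diamond
    \<open>c\<close>, \<open>x\<close>, \<open>y\<close>, \<open>z\<close> makes \<open>x\<close>
    and \<open>y\<close> twins, yet \<open>d\<close> sees only \<open>x\<close>.\<close>
  have disj: "S i \<inter> S (\<not> i) = {}" for i
  proof (rule ccontr)
    assume "S i \<inter> S (\<not> i) \<noteq> {}"
    then obtain x where x: "x \<in> S i" "x \<in> S (\<not> i)" by blast
    have "\<not> S i \<subseteq> S (\<not> i)" "\<not> S (\<not> i) \<subseteq> S i"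
      using Sneq[of i] card_subset_eq[OF finS] cS by metis+
    then obtain y z where y: "y \<in> S i" "y \<notin> S (\<not> i)" and z: "z \<in> S (\<not> i)" "z \<notin> S i" by blast
    obtain c d where c: "c \<in> P i" and d: "d \<in> P (\<not> i)" using Pne by blast
    have inK: "x \<in> ?K" "y \<in> ?K" "z \<in> ?K" using x y z SK[of i] by blast+
    have Nc: "nbhd G c \<inter> ?K = S i" and Nd: "nbhd G d \<inter> ?K = S (\<not> i)"
      using traceP c d by blast+
    have cx: "c \<rightarrow>\<^bsub>G\<^esub> x" and cy: "c \<rightarrow>\<^bsub>G\<^esub> y" and cz: "\<not> c \<rightarrow>\<^bsub>G\<^esub> z"
      and dx: "d \<rightarrow>\<^bsub>G\<^esub> x" and dy: "\<not> d \<rightarrow>\<^bsub>G\<^esub> y"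
      using Nc Nd x y z inK by (auto simp: nbhd_def)
    have ne: "x \<noteq> y" "x \<noteq> z" "y \<noteq> z" "c \<noteq> z" "d \<noteq> y"
      using x y z inK PV c d by blast+
    have "true_twins G x y"
      using strictly_chordal_diamond[OF sc cx cy adjK adjK adjK] inK ne cz by blast
    moreover have "d \<in> insert x (nbhd G x)" "d \<notin> insert y (nbhd G y)"
      using dx dy ne dominates_sym by (auto simp: nbhd_def)
    ultimately show False by (simp add: true_twins_def)
  qed
  have Pdisj: "P i \<inter> P (\<not> i) = {}" for i
    using traceP[of _ i] traceP[of _ "\<not> i"] Sneq[of i] by (metis disjoint_iff)
  have cover: "verts G = (\<Union>i. S i \<union> P i)"
  proof (intro equalityI subsetI)
    fix v assume v: "v \<in> verts G"
    show "v \<in> (\<Union>i. S i \<union> P i)"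
    proof (cases "v \<in> ?K")
      case True
      then have "v \<in> S True \<or> v \<in> S False" using SK[of True] by auto
      then show ?thesis by auto
    next
      case False
      then obtain i where "nbhd G v \<inter> ?K = S i" using trace v by blast
      then have "v \<in> P i" using simp[OF v False] by (auto simp: P_def)
      then show ?thesis by blast
    qed
  next
    fix v assume "v \<in> (\<Union>i. S i \<union> P i)"
    then obtain i where "v \<in> S i \<or> v \<in> P i" by blast
    then show "v \<in> verts G" using PV(1) KV SK[of i] by (metis UnI1 subsetD)
  qed
  have cl: "a \<rightarrow>\<^bsub>G\<^esub> b" if "v \<in> P i" "v \<rightarrow>\<^bsub>G\<^esub> a" "v \<rightarrow>\<^bsub>G\<^esub> b" "a \<noteq> b" for a b v i
    using that by (auto simp: P_def simplicial_def clique_def nbhd_def)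
  \<comment> \<open>As \<open>v\<close> is simplicial, a neighbour outside \<open>?K\<close> is
    adjacent to all of \<open>S i\<close> and thus belongs to the same side.\<close>
  have NP: "nbhd G v \<subseteq> S i \<union> P i" if v: "v \<in> P i" for v i
  proof
    fix w assume w: "w \<in> nbhd G v"
    show "w \<in> S i \<union> P i"
    proof (cases "w \<in> ?K")
      case True then show ?thesis using traceP[OF v] w by (metis IntI UnI1)
    next
      case False
      have wV: "w \<in> verts G" using w by (auto simp: nbhd_def dest: adj_in_verts)
      have "S i \<subseteq> nbhd G w"
      proof
        fix x assume x: "x \<in> S i"
        then have "v \<rightarrow>\<^bsub>G\<^esub> x" "x \<noteq> w" using v False SK[of i] by (auto simp: P_def nbhd_def)
        then show "x \<in> nbhd G w" using cl[OF v] w by (auto simp: nbhd_def)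
      qed
      then show ?thesis using simp[OF wV False] by (simp add: P_def)
    qed
  qed
  have "core_parts G s p S P"
  proof
    fix i j v
    show "verts G = (\<Union>i. S i \<union> P i)" by (rule cover)
    show "S i \<inter> S (\<not> i) = {}" "P i \<inter> P (\<not> i) = {}" by (rule disj Pdisj)+
    show "S i \<inter> P j = {}" using PV(2) SK[of i] by (metis UnI1 disjoint_iff)
    show "card (S i) = s" "card (P i) = p" by (rule cS cP)+
    show "S i \<subseteq> nbhd G v \<and> nbhd G v \<subseteq> S i \<union> P i" if "v \<in> P i" using that NP by (auto simp: P_def)
    show "nbhd G v = S i \<union> S (\<not> i) \<union> P i - {v}" if v: "v \<in> S i"
    proof (intro equalityI subsetI)
      fix w assume w: "w \<in> nbhd G v"
      then have wv: "v \<rightarrow>\<^bsub>G\<^esub> w" "w \<rightarrow>\<^bsub>G\<^esub> v" using dominates_sym by (auto simp: nbhd_def)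
      then have "w \<noteq> v" "w \<in> verts G" using adj_not_same by (auto dest: adj_in_verts)
      moreover have "w \<notin> P (\<not> i)" 
      proof
        assume w: "w \<in> P (\<not> i)"
        then have "v \<in> nbhd G w \<inter> ?K" using wv v SK[of i] by (auto simp: nbhd_def)
        then show False using traceP[OF w] disj[of i] v by (metis disjoint_iff)
      qed
      moreover have "w \<in> S i \<union> S (\<not> i) \<union> P i \<union> P (\<not> i)"
      proof -
        obtain j where "w \<in> S j \<union> P j" using \<open>w \<in> verts G\<close> cover by auto
        moreover have "j = i \<or> j = (\<not> i)" by auto
        ultimately show ?thesis by auto
      qed
      ultimately show "w \<in> S i \<union> S (\<not> i) \<union> P i - {v}" by blast
    next
      fix w assume w: "w \<in> S i \<union> S (\<not> i) \<union> P i - {v}"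
      show "w \<in> nbhd G v"
      proof (cases "w \<in> P i")
        case True
        then have "v \<in> nbhd G w" using v by (auto simp: P_def)
        then show ?thesis using dominates_sym by (simp add: nbhd_def)
      next
        case False
        then show ?thesis using w v adjK SK[of i] by (auto simp: nbhd_def)
      qed
    qed
    fix w assume v: "v \<in> P i" and w: "w \<in> P i" and vw: "v \<rightarrow>\<^bsub>G\<^esub> w"
    have wv: "w \<rightarrow>\<^bsub>G\<^esub> v" using dominates_sym[OF vw] .
    show "true_twins G v w"
      unfolding true_twins_def using cl[OF v vw] cl[OF w wv] vw wv by (auto simp: nbhd_def)
  qed
  then show thesis by (rule that)
qed

section \<open>Simple eigenvalues of symmetric matrices\<close>

text \<open>The product \<open>\<bullet>\<close> is bilinear, without conjugation, and a complex
  symmetric matrix may have Jordan blocks; requiring \<open>z \<bullet> z \<noteq> 0\<close> rules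
  this out for \<open>x\<close>.\<close>

lemma order_char_poly_le_1:
  fixes A :: "complex mat"
  assumes A: "A \<in> carrier_mat n n" and sym: "transpose_mat A = A"
    and z: "z \<in> carrier_vec n" "z \<bullet> z \<noteq> 0"
    and eigenspace: "\<And>v. v \<in> carrier_vec n \<Longrightarrow> A *\<^sub>v v = x \<cdot>\<^sub>v v \<Longrightarrow> \<exists>c. v = c \<cdot>\<^sub>v z"
  shows "Polynomial.order x (char_poly A) \<le> 1"
proof (rule ccontr)
  txt \<open>
    A Schur decomposition that lists \<open>x\<close> twice at the front yields independent vectors \<open>v\<close> and \<open>w\<close>
    with \<open>A v = x v\<close> and \<open>A w = b v + x w\<close>; symmetry of \<open>A\<close> forces \<open>b = 0\<close>.
  \<close>
  assume "\<not> ?thesis"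
  then have "[:- x, 1:] ^ 2 dvd char_poly A"
    using order_1[of x "char_poly A"] power_le_dvd by (metis not_less_eq_eq numeral_2_eq_2 One_nat_def)
  then obtain r where r: "char_poly A = [:- x, 1:] ^ 2 * r" unfolding dvd_def by auto
  have "lead_coeff (char_poly A) = 1" using degree_monic_char_poly[OF A] by simp
  \<comment> \<open>A monic \<open>r\<close> factors into linear terms without a scalar in front, as
    the Schur decomposition demands.\<close>
  then have "lead_coeff r = 1" unfolding r by (simp only: lead_coeff_mult lead_coeff_power) simp
  then obtain es where es: "r = (\<Prod>a\<leftarrow>es. [:- a, 1:])"
    using fundamental_theorem_algebra_factorized[of r] by auto
  have cp: "char_poly A = (\<Prod>a\<leftarrow>x # x # es. [:- a, 1:])"
    unfolding r es by (simp only: list.map prod_list.Cons power2_eq_square mult.assoc)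
  obtain B P Q where schur: "schur_decomposition A (x # x # es) = (B, P, Q)"
    by (metis prod_cases3)
  have wit: "similar_mat_wit A B P Q" and ut: "upper_triangular B"
    and diag: "diag_mat B = x # x # es"
    using schur_decomposition[OF A cp schur] by auto
  note D = similar_mat_witD2[OF A wit]
  have n2: "n \<ge> 2" using arg_cong[OF diag, of length] D(5) by (simp add: diag_mat_def)
  have B00: "B $$ (0, 0) = x" and B11: "B $$ (1, 1) = x"
    using arg_cong[OF diag, of "\<lambda>l. l ! 0"] arg_cong[OF diag, of "\<lambda>l. l ! 1"] D(5) n2
    by (simp_all add: diag_mat_def)
  have Bl: "B $$ (i, j) = 0" if "j < i" "i < n" for i j
    using ut that D(5) unfolding upper_triangular_def by auto
  let ?e = "\<lambda>i. unit_vec n i :: complex vec"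
  define b where "b = B $$ (0, 1)"
  define v where "v = P *\<^sub>v ?e 0"
  define w where "w = P *\<^sub>v ?e 1"
  have vw: "v \<in> carrier_vec n" "w \<in> carrier_vec n" using D(6) by (auto simp: v_def w_def)
  have Be0: "B *\<^sub>v ?e 0 = x \<cdot>\<^sub>v ?e 0"
  proof (rule eq_vecI)
    fix i assume "i < dim_vec (x \<cdot>\<^sub>v ?e 0)"
    then show "(B *\<^sub>v ?e 0) $ i = (x \<cdot>\<^sub>v ?e 0) $ i"
      using D(5) n2 B00 Bl[of 0 i] by (cases "i = 0") auto
  qed (use D(5) in auto)
  have Be1: "B *\<^sub>v ?e 1 = b \<cdot>\<^sub>v ?e 0 + x \<cdot>\<^sub>v ?e 1"
  proof (rule eq_vecI)
    fix i assume "i < dim_vec (b \<cdot>\<^sub>v ?e 0 + x \<cdot>\<^sub>v ?e 1)"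
    then have i: "i < n" by simp
    consider "i = 0" | "i = 1" | "i > 1" by linarith
    then show "(B *\<^sub>v ?e 1) $ i = (b \<cdot>\<^sub>v ?e 0 + x \<cdot>\<^sub>v ?e 1) $ i"
      using D(5) n2 B11 Bl[of 1 i] i by cases (auto simp: b_def)
  qed (use D(5) in auto)
  have AP: "A *\<^sub>v (P *\<^sub>v y) = P *\<^sub>v (B *\<^sub>v y)" if y: "y \<in> carrier_vec n" for y
  proof -
    have "A * P = P * B * (Q * P)" using D by (simp add: assoc_mult_mat[of _ n n _ n _ n])
    also have "\<dots> = P * B" using D by simp
    finally have "A * P = P * B" .
    then show ?thesis using D y by (metis assoc_mult_mat_vec)
  qed
  have QP: "Q *\<^sub>v (P *\<^sub>v y) = y" if "y \<in> carrier_vec n" for y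
    using D that by (metis assoc_mult_mat_vec one_mult_mat_vec)
  have Av: "A *\<^sub>v v = x \<cdot>\<^sub>v v"
    unfolding v_def by (simp add: AP Be0 mult_mat_vec[OF D(6)])
  have Aw: "A *\<^sub>v w = b \<cdot>\<^sub>v v + x \<cdot>\<^sub>v w"
    unfolding v_def w_def AP[OF unit_vec_carrier] Be1
    by (simp add: mult_mat_vec[OF D(6)] mult_add_distrib_mat_vec[OF D(6)])
  obtain c where c: "v = c \<cdot>\<^sub>v z" using eigenspace[OF vw(1) Av] by blast
  have "c \<noteq> 0"
  proof
    assume "c = 0"
    then have "v = 0 \<cdot>\<^sub>v v" using c z(1) by (intro eq_vecI) auto
    then have "Q *\<^sub>v v = 0 \<cdot>\<^sub>v (Q *\<^sub>v v)" using mult_mat_vec[OF D(7) vw(1)] by metis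
    then have "?e 0 = 0 \<cdot>\<^sub>v ?e 0" unfolding v_def by (simp add: QP)
    then have "?e 0 $ 0 = (0 \<cdot>\<^sub>v ?e 0) $ 0" by (rule arg_cong)
    then show False using n2 by simp
  qed
  \<comment> \<open>Evaluating both sides, the terms \<open>x * (v \<bullet> w)\<close> cancel and
    \<open>b * (v \<bullet> v) = 0\<close> remains.\<close>
  have "v \<bullet> (A *\<^sub>v w) = (A *\<^sub>v v) \<bullet> w"
    using transpose_vec_mult_scalar[OF A vw(2,1)] sym by simp
  also have "\<dots> = x * (v \<bullet> w)" unfolding Av using vw by simp
  finally have "b * (v \<bullet> v) = 0"
    unfolding Aw using vw scalar_prod_add_distrib[of v n "b \<cdot>\<^sub>v v" "x \<cdot>\<^sub>v w"] by simp
  moreover have "v \<bullet> v = c * c * (z \<bullet> z)" unfolding c using z(1) by simp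
  ultimately have "b = 0" using \<open>c \<noteq> 0\<close> z(2) by simp
  then have "A *\<^sub>v w = x \<cdot>\<^sub>v w" unfolding Aw using vw by (intro eq_vecI) auto
  then obtain c' where c': "w = c' \<cdot>\<^sub>v z" using eigenspace vw(2) by blast
  \<comment> \<open>Two columns of the invertible \<open>P\<close> would be proportional; applying
    \<open>Q\<close> makes two distinct unit vectors proportional.\<close>
  have "w = (c' / c) \<cdot>\<^sub>v v" unfolding c c' using \<open>c \<noteq> 0\<close> z(1) by (intro eq_vecI) auto
  then have "Q *\<^sub>v w = (c' / c) \<cdot>\<^sub>v (Q *\<^sub>v v)" using mult_mat_vec[OF D(7) vw(1)] by metis
  then have "?e 1 = (c' / c) \<cdot>\<^sub>v ?e 0" unfolding v_def w_def by (simp add: QP)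
  then have "?e 1 $ 1 = ((c' / c) \<cdot>\<^sub>v ?e 0) $ 1" by (rule arg_cong)
  then show False using n2 by simp
qed

section \<open>The Laplacian as an operator on functions\<close>

text \<open>The Laplacian acting on vertex functions, which frees the spectral argument from the
  enumeration \<open>vs\<close>. Values are complex because the multiplicity bound rests on a full
  triangularization.\<close>

definition laplace_op :: "('a, 'b) pre_digraph \<Rightarrow> ('a \<Rightarrow> complex) \<Rightarrow> 'a \<Rightarrow> complex" where
  "laplace_op G f v = (\<Sum>u\<in>nbhd G v. f v - f u)"

abbreviation complex_laplacian :: "('a, 'b) pre_digraph \<Rightarrow> 'a list \<Rightarrow> complex mat" where
  "complex_laplacian G vs \<equiv> map_mat complex_of_real (laplacian G vs)"

lemma laplacian_carrier: "laplacian G vs \<in> carrier_mat (length vs) (length vs)"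
  by (rule carrier_matI) (simp_all add: laplacian_def degree_matrix_def adjacency_matrix_def)

text \<open>Without parallel arcs, an arc leaving \<open>v\<close> is determined by its
  head.\<close>

lemma (in graph) out_degree_eq_card_nbhd: "out_degree G v = card (nbhd G v)"
proof -
  have "inj_on (head G) (out_arcs G v)"
    by (rule inj_onI) (auto simp: arc_to_ends_def intro: no_multi_arcs)
  moreover have "head G ` out_arcs G v = nbhd G v"
    by (auto simp: nbhd_def arcs_ends_conv)
  ultimately show ?thesis unfolding out_degree_def using card_image by metis
qed

lemma (in graph) transpose_complex_laplacian:
  "transpose_mat (complex_laplacian G vs) = complex_laplacian G vs"
  by (rule eq_matI)
    (auto simp: laplacian_def degree_matrix_def adjacency_matrix_def dest: dominates_sym)

lemma (in graph) laplacian_mult_vec: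
  assumes "distinct vs" and vs: "set vs = verts G"
  shows "complex_laplacian G vs *\<^sub>v vec (length vs) (\<lambda>i. f (vs ! i)) =
    vec (length vs) (\<lambda>i. laplace_op G f (vs ! i))"
proof (rule eq_vecI)
  let ?n = "length vs"
  fix i assume "i < dim_vec (vec ?n (\<lambda>i. laplace_op G f (vs ! i)))"
  then have i: "i < ?n" by simp
  let ?v = "vs ! i"
  have sub: "nbhd G ?v \<subseteq> set vs" using vs by (auto simp: nbhd_def dest: adj_in_verts)
  have "(complex_laplacian G vs *\<^sub>v vec ?n (\<lambda>i. f (vs ! i))) $ i =
      (\<Sum>j<?n. complex_of_real (laplacian G vs $$ (i, j)) * f (vs ! j))"
    using i laplacian_carrier[of G vs] by (auto simp: scalar_prod_def lessThan_atLeast0)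
  also have "\<dots> = (\<Sum>j<?n. (if j = i then of_nat (out_degree G ?v) * f ?v else 0)
      - (if vs ! j \<in> nbhd G ?v then f (vs ! j) else 0))"
    using i by (intro sum.cong)
      (auto simp: laplacian_def degree_matrix_def adjacency_matrix_def nbhd_def algebra_simps)
  also have "\<dots> = of_nat (out_degree G ?v) * f ?v
      - (\<Sum>j<?n. if vs ! j \<in> nbhd G ?v then f (vs ! j) else 0)"
    using i by (simp add: sum_subtractf)
  also have "(\<Sum>j<?n. if vs ! j \<in> nbhd G ?v then f (vs ! j) else 0) =
      (\<Sum>u\<in>set vs. if u \<in> nbhd G ?v then f u else 0)"
    by (rule sum.reindex_bij_betw[OF bij_betw_nth]) (use assms in auto)
  also have "\<dots> = sum f (nbhd G ?v)"
    using sub by (simp add: sum.If_cases Int_absorb1)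
  finally show "(complex_laplacian G vs *\<^sub>v vec ?n (\<lambda>i. f (vs ! i))) $ i =
      vec ?n (\<lambda>i. laplace_op G f (vs ! i)) $ i"
    using i by (simp add: laplace_op_def sum_subtractf out_degree_eq_card_nbhd)
qed (simp add: laplacian_def degree_matrix_def adjacency_matrix_def)

lemma vec_of_function:
  assumes "distinct vs" and "v \<in> carrier_vec (length vs)"
  obtains f where "v = vec (length vs) (\<lambda>i. f (vs ! i))"
proof
  have "inj_on ((!) vs) {..<length vs}" using assms(1) by (simp add: inj_on_nth)
  then show "v = vec (length vs) (\<lambda>i. (\<lambda>a. v $ inv_into {..<length vs} ((!) vs) a) (vs ! i))"
    using assms(2) by (intro eq_vecI) auto
qed

section \<open>Eigenfunctions of core graphs\<close>

context core_parts
begin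

lemma finite_S [simp]: "finite (S i)" and finite_P [simp]: "finite (P i)"
  using finite_verts unfolding verts_eq by (auto intro: finite_subset[rotated])

text \<open>Adding the vanishing term \<open>u = v\<close> completes the sum to whole classes,
  \<open>2 * s + p\<close> vertices in all.\<close>

lemma laplace_op_S:
  assumes "v \<in> S i"
  shows "laplace_op G f v =
    of_nat (2 * s + p) * f v - (sum f (S i) + sum f (S (\<not> i)) + sum f (P i))"
proof -
  let ?A = "S i \<union> S (\<not> i) \<union> P i"
  have "laplace_op G f v = (\<Sum>u\<in>?A. f v - f u)"
    unfolding laplace_op_def nbhd_S[OF assms] by (rule sum.mono_neutral_left) auto
  also have "\<dots> = of_nat (card ?A) * f v - sum f ?A" by (simp add: sum_subtractf)
  also have "card ?A = 2 * s + p"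
    using S_disjoint[of i] SP_disjoint by (simp add: card_Un_disjoint Int_Un_distrib2 card_S card_P)
  also have "sum f ?A = sum f (S i) + sum f (S (\<not> i)) + sum f (P i)"
    using S_disjoint[of i] SP_disjoint by (simp add: sum.union_disjoint Int_Un_distrib2)
  finally show ?thesis .
qed

text \<open>For \<open>v\<close> in \<open>P i\<close>, this is the complete component of the graph
  induced by \<open>P i\<close> that contains \<open>v\<close>.\<close>

definition twin_class :: "'a \<Rightarrow> bool \<Rightarrow> 'a set" where
  "twin_class v i = insert v (nbhd G v) \<inter> P i"

lemma laplace_op_P:
  assumes v: "v \<in> P i"
  shows "laplace_op G f v =
    of_nat (s + card (twin_class v i)) * f v - (sum f (S i) + sum f (twin_class v i))"
proof -
  let ?A = "S i \<union> twin_class v i"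
  have dj: "S i \<inter> twin_class v i = {}" using SP_disjoint by (auto simp: twin_class_def)
  have "v \<notin> nbhd G v" using adj_not_same by (auto simp: nbhd_def)
  then have N: "nbhd G v = ?A - {v}"
    using nbhd_P[OF v] SP_disjoint[of i i] v by (auto simp: twin_class_def)
  have fin: "finite (twin_class v i)" by (simp add: twin_class_def)
  have "laplace_op G f v = (\<Sum>u\<in>?A. f v - f u)"
    unfolding laplace_op_def N by (rule sum.mono_neutral_left) (use fin in auto)
  also have "\<dots> = of_nat (card ?A) * f v - sum f ?A" by (simp add: sum_subtractf)
  also have "card ?A = s + card (twin_class v i)" using dj fin by (simp add: card_Un_disjoint card_S)
  also have "sum f ?A = sum f (S i) + sum f (twin_class v i)"
    using dj fin by (simp add: sum.union_disjoint)
  finally show ?thesis .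
qed

lemma twin_class_eq:
  assumes "v \<in> P i" and "w \<in> twin_class v i"
  shows "twin_class w i = twin_class v i"
  using assms twins_P[of v i w] by (auto simp: twin_class_def true_twins_def nbhd_def)

abbreviation side :: "bool \<Rightarrow> complex" where
  "side i \<equiv> if i then 1 else -1"

text \<open>Antisymmetric between the sides. The values \<open>s - x\<close> and \<open>s\<close>
  solve the eigenvalue equation at \<open>P i\<close>, namely \<open>(s - x) * b = s * a\<close>,
  without division.\<close>

definition eigenfun :: "complex \<Rightarrow> 'a \<Rightarrow> complex" where
  "eigenfun x v = side (v \<in> S True \<union> P True) *
     (if v \<in> S True \<union> S False then of_nat s - x else of_nat s)"

lemma eigenfun_S: "v \<in> S i \<Longrightarrow> eigenfun x v = side i * (of_nat s - x)"
  using S_disjoint[of True] SP_disjoint by (cases i) (auto simp: eigenfun_def)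

lemma eigenfun_P: "v \<in> P i \<Longrightarrow> eigenfun x v = side i * of_nat s"
  using P_disjoint[of True] SP_disjoint by (cases i) (auto simp: eigenfun_def)

text \<open>The equation at \<open>P i\<close> holds for every \<open>x\<close> by the choice of
  values; the equation at \<open>S i\<close> is precisely the quadratic \<open>q\<close>.\<close>

lemma laplace_op_eigenfun:
  assumes q: "x ^ 2 - of_nat (3 * s + p) * x + 2 * of_nat s ^ 2 = 0" and v: "v \<in> verts G"
  shows "laplace_op G (eigenfun x) v = x * eigenfun x v"
proof -
  have sumS: "sum (eigenfun x) (S i) = of_nat s * (side i * (of_nat s - x))" for i
    using eigenfun_S by (simp add: card_S cong: sum.cong)
  have sumP: "sum (eigenfun x) A = of_nat (card A) * (side i * of_nat s)" if "A \<subseteq> P i" for A i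
  proof -
    have "sum (eigenfun x) A = (\<Sum>u\<in>A. side i * of_nat s)"
      by (rule sum.cong) (use eigenfun_P that in auto)
    then show ?thesis by simp
  qed
  obtain i where "v \<in> S i \<or> v \<in> P i" using v verts_eq by blast
  then show ?thesis
  proof
    assume v: "v \<in> S i"
    have "side i * (x ^ 2 - of_nat (3 * s + p) * x + 2 * of_nat s ^ 2) = 0" using q by simp
    then show ?thesis
      unfolding laplace_op_S[OF v] sumS sumP[OF subset_refl] eigenfun_S[OF v] card_P
      by (cases i) (simp_all add: algebra_simps power2_eq_square)
  next
    assume v: "v \<in> P i"
    have "twin_class v i \<subseteq> P i" by (simp add: twin_class_def)
    then show ?thesis
      unfolding laplace_op_P[OF v] sumS eigenfun_P[OF v] by (simp add: sumP algebra_simps)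
  qed
qed

text \<open>
  Below, \<open>a i\<close> and \<open>b i\<close> are the values of \<open>f\<close> on \<open>S i\<close> and \<open>P i\<close>. The symmetric part of \<open>f\<close>,
  represented by \<open>A\<close>, vanishes because its eigenvalue would be \<open>0\<close> or \<open>s + p\<close>.
\<close>

lemma eigenfunction_cases:
  assumes x: "x \<notin> \<int>" and "s > 0"
    and eig: "\<And>v. v \<in> verts G \<Longrightarrow> laplace_op G f v = x * f v"
  obtains c where "\<And>v. v \<in> verts G \<Longrightarrow> f v = c * eigenfun x v"
    and "c = 0 \<or> x ^ 2 - of_nat (3 * s + p) * x + 2 * of_nat s ^ 2 = 0"
proof -
  \<comment> \<open>All cancellations below are by factors of this form; this is where
    non-integrality of \<open>x\<close> enters.\<close>
  have nat_neq: "of_nat k - x \<noteq> 0" for k using x Ints_of_nat by (metis eq_iff_diff_eq_0)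
  have SV: "v \<in> verts G" if "v \<in> S i \<or> v \<in> P i" for v i using that verts_eq by blast
  have "\<exists>a. \<forall>v\<in>S i. f v = a" for i
  proof -
    have "f v = f w" if v: "v \<in> S i" and w: "w \<in> S i" for v w
    proof -
      have "of_nat (2 * s + p) * f v - x * f v = of_nat (2 * s + p) * f w - x * f w"
        using eig[of v] eig[of w] SV[of v i] SV[of w i] v w
        unfolding laplace_op_S[OF v] laplace_op_S[OF w] by (simp add: algebra_simps)
      then have "(of_nat (2 * s + p) - x) * (f v - f w) = 0" by (simp add: algebra_simps)
      then show ?thesis using nat_neq by (metis mult_eq_0_iff right_minus_eq)
    qed
    then show ?thesis by blast
  qed
  then obtain a where a: "\<And>i v. v \<in> S i \<Longrightarrow> f v = a i" by metis
  have sumS: "sum f (S i) = of_nat s * a i" for i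
    using a by (simp add: card_S cong: sum.cong)
  have fP: "f v = of_nat s * a i / (of_nat s - x)" if v: "v \<in> P i" for v i
  proof -
    let ?C = "twin_class v i"
    have "f w = f v" if w: "w \<in> ?C" for w
    proof -
      have wP: "w \<in> P i" using w by (simp add: twin_class_def)
      have "of_nat (s + card ?C) * f v - x * f v = of_nat (s + card ?C) * f w - x * f w"
        using eig[of v] eig[of w] SV[of v i] SV[of w i] v wP twin_class_eq[OF v w]
        unfolding laplace_op_P[OF v] laplace_op_P[OF wP] by (simp add: algebra_simps)
      then have "(of_nat (s + card ?C) - x) * (f v - f w) = 0" by (simp add: algebra_simps)
      then show ?thesis using nat_neq by (metis mult_eq_0_iff right_minus_eq)
    qed
    then have "sum f ?C = of_nat (card ?C) * f v" by simp
    \<comment> \<open>The size of the twin class cancels, so \<open>f\<close> takes one value on all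
      of \<open>P i\<close>, however \<open>P i\<close> splits into cliques.\<close>
    then have "(of_nat s - x) * f v = of_nat s * a i"
      using eig[of v] SV[of v i] v unfolding laplace_op_P[OF v] sumS by (simp add: algebra_simps)
    then show ?thesis using nat_neq[of s] by (simp add: field_simps)
  qed
  define b where "b i = of_nat s * a i / (of_nat s - x)" for i
  have b: "(of_nat s - x) * b i = of_nat s * a i" for i using nat_neq[of s] by (simp add: b_def)
  have fP': "f v = b i" if "v \<in> P i" for v i using fP[OF that] by (simp add: b_def)
  have sumP: "sum f (P i) = of_nat p * b i" for i
    using fP' by (simp add: card_P cong: sum.cong)
  have eqS: "(of_nat (s + p) - x) * a i - of_nat s * a (\<not> i) = of_nat p * b i" for i
  proof -
    obtain v where v: "v \<in> S i" using \<open>s > 0\<close> card_S[of i] by (metis card_gt_0_iff ex_in_conv)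
    show ?thesis
      using eig[of v] SV[of v i] v unfolding laplace_op_S[OF v] sumS sumP a[OF v] by (simp add: algebra_simps)
  qed
  define A where "A = a True + a False"
  \<comment> \<open>Summing over the two sides and eliminating the \<open>b i\<close> leaves
    \<open>A\<close> times a quadratic with roots \<open>0\<close> and \<open>s + p\<close>.\<close>
  have "(of_nat p - x) * A = of_nat p * (b True + b False)"
    using arg_cong2[OF eqS[of True] eqS[of False], of "(+)"] by (simp add: A_def algebra_simps)
  moreover have "(of_nat s - x) * (b True + b False) = of_nat s * A"
    using b[of True] b[of False] by (simp add: A_def algebra_simps)
  ultimately have "(of_nat s - x) * (of_nat p - x) * A = of_nat p * (of_nat s * A)"
    by (metis (no_types, lifting) mult.assoc mult.left_commute)
  then have "(of_nat 0 - x) * (of_nat (s + p) - x) * A = 0" by (simp add: algebra_simps)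
  then have "A = 0" using nat_neq[of 0] nat_neq[of "s + p"] by simp
  then have aF: "a False = - a True" by (simp add: A_def eq_neg_iff_add_eq_0 add.commute)
  have a_side: "a i = side i * a True" for i by (cases i) (simp_all add: aF)
  show thesis
  proof (rule that)
    fix v assume "v \<in> verts G"
    then obtain i where "v \<in> S i \<or> v \<in> P i" using verts_eq by blast
    \<comment> \<open>The factor is fixed by comparing values on \<open>S True\<close>, where
      \<open>eigenfun\<close> equals \<open>s - x\<close>.\<close>
    then show "f v = a True / (of_nat s - x) * eigenfun x v"
    proof
      assume v: "v \<in> S i"
      show ?thesis using a[OF v] a_side[of i] nat_neq[of s] by (simp add: eigenfun_S[OF v])
    next
      assume v: "v \<in> P i"
      show ?thesis using fP[OF v] a_side[of i] by (simp add: eigenfun_P[OF v])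
    qed
  next
    have "(of_nat s - x) * ((of_nat (2 * s + p) - x) * a True) =
        of_nat p * ((of_nat s - x) * b True)"
      using eqS[of True] by (simp add: aF algebra_simps)
    then have "(x ^ 2 - of_nat (3 * s + p) * x + 2 * of_nat s ^ 2) * a True = 0"
      unfolding b by (simp add: algebra_simps power2_eq_square)
    then show "a True / (of_nat s - x) = 0 \<or>
        x ^ 2 - of_nat (3 * s + p) * x + 2 * of_nat s ^ 2 = 0" by auto
  qed
qed

section \<open>Non-integral eigenvalues of core graphs\<close>

definition eigenvec :: "'a list \<Rightarrow> complex \<Rightarrow> complex vec" where
  "eigenvec vs x = vec (length vs) (\<lambda>i. eigenfun x (vs ! i))"

text \<open>For real \<open>r\<close> all entries are real, so the bilinear product is a sum of
  squares; a vertex of \<open>P True\<close> contributes the positive term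
  \<open>s ^ 2\<close>.\<close>

lemma eigenvec_scalar_prod_neq_0:
  assumes "s > 0" "p > 0" and vs: "set vs = verts G"
  shows "eigenvec vs (complex_of_real r) \<bullet> eigenvec vs (complex_of_real r) \<noteq> 0"
proof -
  let ?z = "eigenfun (complex_of_real r)"
  have real: "?z v = complex_of_real (Re (?z v))" for v by (simp add: eigenfun_def)
  obtain v where v: "v \<in> P True" using \<open>p > 0\<close> card_P[of True] by (metis card_gt_0_iff ex_in_conv)
  then obtain i where i: "i < length vs" "vs ! i = v"
    using vs verts_eq by (metis UN_I UNIV_I UnI2 in_set_conv_nth)
  have "(Re (?z (vs ! i)))\<^sup>2 > 0" using i \<open>s > 0\<close> by (simp add: eigenfun_P[OF v])
  then have "(\<Sum>j<length vs. (Re (?z (vs ! j)))\<^sup>2) > 0"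
    using i by (intro sum_pos2[of _ i]) auto
  moreover have "eigenvec vs (complex_of_real r) \<bullet> eigenvec vs (complex_of_real r) =
      complex_of_real (\<Sum>j<length vs. (Re (?z (vs ! j)))\<^sup>2)"
    unfolding scalar_prod_def eigenvec_def of_real_sum
    by (rule sum.cong) (use real in \<open>auto simp: lessThan_atLeast0 power2_eq_square\<close>)
  ultimately show ?thesis by (metis less_irrefl of_real_eq_0_iff)
qed

lemma complex_of_real_quadratic:
  "complex_of_real r ^ 2 - of_nat (3 * s + p) * complex_of_real r + 2 * of_nat s ^ 2 = 0 \<longleftrightarrow>
   r ^ 2 - real (3 * s + p) * r + 2 * real s ^ 2 = 0"
proof -
  have "complex_of_real r ^ 2 - of_nat (3 * s + p) * complex_of_real r + 2 * of_nat s ^ 2 =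
      complex_of_real (r ^ 2 - real (3 * s + p) * r + 2 * real s ^ 2)" by simp
  then show ?thesis by (simp only: of_real_eq_0_iff)
qed

text \<open>The embedding of the reals into the complex numbers preserves roots of the
  characteristic polynomial and their orders, so both claims are settled over the complex
  numbers.\<close>

lemma noninteger_eigenvalue:
  assumes sp: "s > 0" "p > 0" and r: "r \<notin> \<int>"
    and vs: "distinct vs" "set vs = verts G"
  shows "eigenvalue (laplacian G vs) r \<longleftrightarrow> r ^ 2 - real (3 * s + p) * r + 2 * real s ^ 2 = 0"
    and "Polynomial.order r (char_poly (laplacian G vs)) \<le> 1"
proof -
  let ?n = "length vs" and ?x = "complex_of_real r" and ?L = "complex_laplacian G vs"
  let ?z = "eigenvec vs ?x"
  have x: "?x \<notin> \<int>"
  proof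
    assume "?x \<in> \<int>"
    then obtain k where "?x = of_int k" by (auto elim: Ints_cases)
    then have "r = of_int k" by (metis of_real_eq_iff of_real_of_int_eq)
    then show False using r by simp
  qed
  have L: "?L \<in> carrier_mat ?n ?n" using laplacian_carrier[of G vs] by simp
  have cp: "char_poly ?L = map_poly complex_of_real (char_poly (laplacian G vs))"
    by (rule of_real_hom.char_poly_hom[OF laplacian_carrier])
  have ev: "eigenvalue (laplacian G vs) r \<longleftrightarrow> eigenvalue ?L ?x"
    unfolding eigenvalue_root_char_poly[OF L] eigenvalue_root_char_poly[OF laplacian_carrier] cp
    by simp
  have z: "?z \<in> carrier_vec ?n" "?z \<bullet> ?z \<noteq> 0"
    using eigenvec_scalar_prod_neq_0[OF sp vs(2)] by (simp_all add: eigenvec_def)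
  \<comment> \<open>The first conjunct feeds the multiplicity bound; the alternative for
    \<open>c\<close> yields the quadratic as soon as \<open>v\<close> is non-zero.\<close>
  have space: "\<exists>c. v = c \<cdot>\<^sub>v ?z \<and>
      (c = 0 \<or> ?x ^ 2 - of_nat (3 * s + p) * ?x + 2 * of_nat s ^ 2 = 0)"
    if v: "v \<in> carrier_vec ?n" and Lv: "?L *\<^sub>v v = ?x \<cdot>\<^sub>v v" for v
  proof -
    obtain f where f: "v = vec ?n (\<lambda>i. f (vs ! i))" using vec_of_function[OF vs(1) v] .
    have "laplace_op G f a = ?x * f a" if a: "a \<in> verts G" for a
    proof -
      obtain i where i: "i < ?n" "vs ! i = a" using a vs(2) by (metis in_set_conv_nth)
      have "vec ?n (\<lambda>i. laplace_op G f (vs ! i)) $ i = (?x \<cdot>\<^sub>v v) $ i"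
        using Lv unfolding f laplacian_mult_vec[OF vs] by simp
      then show ?thesis using i by (simp add: f)
    qed
    from eigenfunction_cases[OF x sp(1) this] obtain c
      where c: "\<And>a. a \<in> verts G \<Longrightarrow> f a = c * eigenfun ?x a"
        and q: "c = 0 \<or> ?x ^ 2 - of_nat (3 * s + p) * ?x + 2 * of_nat s ^ 2 = 0" by blast
    have "f (vs ! i) = c * eigenfun ?x (vs ! i)" if "i < ?n" for i
      using c nth_mem[OF that] vs(2) by simp
    then have "v = c \<cdot>\<^sub>v ?z" unfolding f eigenvec_def by (intro eq_vecI) auto
    then show ?thesis using q by blast
  qed
  show "eigenvalue (laplacian G vs) r \<longleftrightarrow> r ^ 2 - real (3 * s + p) * r + 2 * real s ^ 2 = 0"
    unfolding ev complex_of_real_quadratic[symmetric]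
  proof
    assume "eigenvalue ?L ?x"
    then obtain v where v: "v \<in> carrier_vec ?n" "v \<noteq> 0\<^sub>v ?n" "?L *\<^sub>v v = ?x \<cdot>\<^sub>v v"
      using L unfolding eigenvalue_def eigenvector_def by auto
    obtain c where c: "v = c \<cdot>\<^sub>v ?z"
      and q: "c = 0 \<or> ?x ^ 2 - of_nat (3 * s + p) * ?x + 2 * of_nat s ^ 2 = 0"
      using space[OF v(1,3)] by blast
    have "c \<noteq> 0" using v(2) z(1) unfolding c by auto
    then show "?x ^ 2 - of_nat (3 * s + p) * ?x + 2 * of_nat s ^ 2 = 0" using q by blast
  next
    assume q: "?x ^ 2 - of_nat (3 * s + p) * ?x + 2 * of_nat s ^ 2 = 0"
    have "?L *\<^sub>v ?z = vec ?n (\<lambda>i. laplace_op G (eigenfun ?x) (vs ! i))"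
      unfolding eigenvec_def by (rule laplacian_mult_vec[OF vs])
    also have "\<dots> = ?x \<cdot>\<^sub>v ?z"
    proof -
      have "laplace_op G (eigenfun ?x) (vs ! i) = ?x * eigenfun ?x (vs ! i)" if "i < ?n" for i
        using laplace_op_eigenfun[OF q] nth_mem[OF that] vs(2) by simp
      then show ?thesis unfolding eigenvec_def by (intro eq_vecI) auto
    qed
    finally have "?L *\<^sub>v ?z = ?x \<cdot>\<^sub>v ?z" .
    moreover have "?z \<noteq> 0\<^sub>v ?n" using z by auto
    ultimately show "eigenvalue ?L ?x"
      using L z(1) unfolding eigenvalue_def eigenvector_def by auto
  qed
  interpret of_real: map_poly_inj_idom_divide_hom complex_of_real ..
  have "Polynomial.order ?x (char_poly ?L) \<le> 1"
    by (rule order_char_poly_le_1[OF L transpose_complex_laplacian z]) (use space in blast)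
  then show "Polynomial.order r (char_poly (laplacian G vs)) \<le> 1"
    unfolding cp by (simp add: of_real.order_hom)
qed

end

section \<open>Integrality of the quadratic's roots and the final count\<close>

text \<open>The roots are distinct by the positive discriminant and add up to the integer
  \<open>b\<close>, so one is an integer exactly when the other is.\<close>

lemma quadratic_noninteger_roots:
  fixes b c :: int
  assumes "b ^ 2 - 4 * c > 0"
  shows "card {r :: real. r \<notin> \<int> \<and> r ^ 2 - of_int b * r + of_int c = 0} \<in> {0, 2}"
proof -
  define d where "d = sqrt (of_int (b ^ 2 - 4 * c))"
  have d: "d > 0" "d * d = of_int (b ^ 2 - 4 * c)"
    using assms by (simp_all add: d_def flip: of_int_power)
  define r1 r2 where "r1 = (of_int b + d) / 2" and "r2 = (of_int b - d) / 2"
  have "r ^ 2 - of_int b * r + of_int c = (r - r1) * (r - r2)" for r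
    using d(2) by (simp add: r1_def r2_def field_simps power2_eq_square)
  then have roots: "r ^ 2 - of_int b * r + of_int c = 0 \<longleftrightarrow> r = r1 \<or> r = r2" for r by simp
  have "r1 = of_int b - r2" "r2 = of_int b - r1" by (simp_all add: r1_def r2_def field_simps)
  then have int: "r1 \<in> \<int> \<longleftrightarrow> r2 \<in> \<int>" by (metis Ints_diff Ints_of_int)
  have "r1 \<noteq> r2" using d(1) by (simp add: r1_def r2_def)
  moreover have "{r. r \<notin> \<int> \<and> r ^ 2 - of_int b * r + of_int c = 0} =
      (if r1 \<in> \<int> then {} else {r1, r2})"
    using int roots by auto
  ultimately show ?thesis by simp
qed

theorem theorem10:
  fixes G :: "('a, 'b) pre_digraph" and s p :: nat and vs :: "'a list"
  assumes "s \<ge> 2" and "p \<ge> 2"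
    and "G \<in> SI_core s p"
    and "\<not> digraph_iso G (G_min s p)"
    and "distinct vs" and "set vs = verts G"
  shows "noninteger_eigenvalue_count (laplacian G vs) = 0 \<or>
         noninteger_eigenvalue_count (laplacian G vs) = 2"
proof -
  obtain S P where "core_parts G s p S P" using SI_core_parts[OF assms(3,2)] .
  then interpret core_parts G s p S P .
  let ?L = "laplacian G vs" and ?b = "int (3 * s + p)" and ?c = "2 * int s ^ 2"
  let ?E = "{r. eigenvalue ?L r \<and> r \<notin> \<int>}"
  have sp: "s > 0" "p > 0" using assms(1,2) by auto
  note ni = noninteger_eigenvalue[OF sp _ assms(5,6)]
  \<comment> \<open>With all multiplicities equal to one, the weighted count becomes the cardinality
    of \<open>?E\<close>.\<close>
  have ord: "Polynomial.order r (char_poly ?L) = 1" if r: "r \<in> ?E" for r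
  proof -
    have "char_poly ?L \<noteq> 0" using degree_monic_char_poly[OF laplacian_carrier[of G vs]] by auto
    moreover have "poly (char_poly ?L) r = 0"
      using r eigenvalue_root_char_poly[OF laplacian_carrier[of G vs]] by simp
    ultimately have "Polynomial.order r (char_poly ?L) \<noteq> 0" by (simp add: order_root)
    moreover have "Polynomial.order r (char_poly ?L) \<le> 1" using ni(2) r by simp
    ultimately show ?thesis by linarith
  qed
  have E: "?E = {r. r \<notin> \<int> \<and> r ^ 2 - of_int ?b * r + of_int ?c = 0}" using ni(1) by auto
  have discr: "?b ^ 2 - 4 * ?c > 0"
  proof -
    have "?b ^ 2 - 4 * ?c = int s ^ 2 + 6 * int s * int p + int p ^ 2"
      by (simp add: power2_eq_square algebra_simps)
    then show ?thesis using sp by (simp add: add_pos_pos)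
  qed
  have "card ?E \<in> {0, 2}" unfolding E by (rule quadratic_noninteger_roots[OF discr])
  moreover have "noninteger_eigenvalue_count ?L = card ?E"
    unfolding noninteger_eigenvalue_count_def using ord by simp
  ultimately show ?thesis by simp
qed

end
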